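(* The following hold. (a) For every weak P-ideal $\mathcal{I}$ on $\omega$, $$\mathfrak{b}\leq \mathrm{non}(\mathcal{I}\text{QN-space})\leq \mathrm{non}(\mathcal{I}\text{wQN-space})=\kappa(\mathcal{I})\leq\mathfrak{d}.$$ (b) For every ideal $\mathcal{I}$ on $\omega$ which is $\leq_K$-below some $F_\sigma$ ideal, $$\mathrm{non}(\mathcal{I}\text{QN-space})=\mathrm{non}(\mathcal{I}\text{wQN-space})=\kappa(\mathcal{I})=\mathfrak{b}.$$
   Context: An ideal on a countable set $M$ is a proper subfamily of $\mathcal{P}(M)$ closed under finite unions and subsets and containing all finite subsets of $M$. $\mathrm{Fin}$ is the ideal of finite subsets of $\omega$. An ideal $\mathcal I$ on $M$ is a weak P-ideal if for every partition $\{A_n:n\in\omega\}\subseteq\mathcal I$ of $M$ there is $A\notin\mathcal I$, $A\subseteq M$, with $A_n\cap A$ finite for all $n$. $F_\sigma$ refers to the topology on $\mathcal P(\omega)\cong 2^\omega$. $\mathcal I\leq_K\mathcal J$ (Katětov order; $\mathcal I$ is $\leq_K$-below $\mathcal J$) means that there is $f:\omega\to\omega$ with $f^{-1}[A]\in\mathcal J$ for all $A\in\mathcal I$. A sequence of reals $(x_n)$ is $\mathcal I$-convergent to $x$ if $\{n:|x_n-x|\ge\varepsilon\}\in\mathcal I$ for all $\varepsilon>0$. A sequence $(f_n)\subseteq\mathbb R^X$ $\mathcal I$QN-converges to $f\in\mathbb R^X$ if there are positive reals $\varepsilon_n$, with $(\varepsilon_n)$ $\mathcal I$-convergent to $0$,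 such that $\{n:|f_n(x)-f(x)|\ge\varepsilon_n\}\in\mathcal I$ for each $x\in X$. For infinite $B\subseteq\omega$, $e_B:\omega\to B$ is its increasing enumeration. A topological space $X$ is an $\mathcal I$QN-space if every sequence of continuous functions $f_n:X\to\mathbb R$ converging pointwise to $0$ $\mathcal I$QN-converges to $0$; it is an $\mathcal I$wQN-space if for every such sequence there is an infinite $B\subseteq\omega$ such that $(f_{e_B(n)})_n$ $\mathcal I$QN-converges to $0$. $\mathrm{non}(\mathcal I\text{QN-space})$ (resp. $\mathrm{non}(\mathcal I\text{wQN-space})$) is the minimal cardinality of a perfectly normal topological space which is not an $\mathcal I$QN-space (resp. not an $\mathcal I$wQN-space). $\kappa(\mathcal I)$ is the minimal cardinality of a family $\mathcal A\subseteq\mathrm{Fin}^\omega$ (sequences of finite subsets of $\omega$) such that for every partition $(B_n)_{n\in\omega\cup\{-1\}}$ of $\omega$ (pieces may be empty), with $B=\bigcup_{n\in\omega}B_n$ infinite and $e_B^{-1}[B_n]\in\mathcal I$ for all $n\in\omega$, there is $(A_n)\in\mathcal A$ with $e_B^{-1}\left[\bigcup_{n\in\omega}A_n\cap B_n\right]\notin\mathcal I$. $\mathfrak b$ and $\mathfrak d$ are the usual bounding and dominating numbers. *)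

theory Defs
  imports "HOL-Analysis.Analysis"
begin

unbundle cardinal_syntax

section \<open>Ideals\<close>

definition ideal_on :: "'a set \<Rightarrow> 'a set set \<Rightarrow> bool" where
  "ideal_on M I \<longleftrightarrow>
     countable M \<and> I \<subset> Pow M \<and>
     (\<forall>A. A \<subseteq> M \<and> finite A \<longrightarrow> A \<in> I) \<and>
     (\<forall>A\<in>I. \<forall>B. B \<subseteq> A \<longrightarrow> B \<in> I) \<and>
     (\<forall>A\<in>I. \<forall>B\<in>I. A \<union> B \<in> I)"

(* Pieces of the partition may be empty.  This makes no difference: an ideal on M contains no
   finite cover of M, so infinitely many pieces are non-empty and these can be reindexed. *)
definition weak_P_ideal :: "'a set \<Rightarrow> 'a set set \<Rightarrow> bool" where
  "weak_P_ideal M I \<longleftrightarrow>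
     ideal_on M I \<and>
     (\<forall>A :: nat \<Rightarrow> 'a set.
        disjoint_family A \<and> (\<Union>n. A n) = M \<and> (\<forall>n. A n \<in> I) \<longrightarrow>
        (\<exists>S. S \<subseteq> M \<and> S \<notin> I \<and> (\<forall>n. finite (A n \<inter> S))))"

definition cantor_topology :: "(nat \<Rightarrow> bool) topology" where
  "cantor_topology = product_topology (\<lambda>_. discrete_topology UNIV) UNIV"

(* Sets of natural numbers are identified with their characteristic functions. *)
definition F_sigma_ideal :: "nat set set \<Rightarrow> bool" where
  "F_sigma_ideal I \<longleftrightarrow>
     ideal_on UNIV I \<and> fsigma_in cantor_topology ((\<lambda>A n. n \<in> A) ` I)"

definition katetov_le :: "nat set set \<Rightarrow> nat set set \<Rightarrow> bool" where
  "katetov_le I J \<longleftrightarrow> (\<exists>f :: nat \<Rightarrow> nat. \<forall>A\<in>I. f -` A \<in> J)"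

section \<open>Ideal convergence\<close>

definition ideal_convergent :: "nat set set \<Rightarrow> (nat \<Rightarrow> real) \<Rightarrow> real \<Rightarrow> bool" where
  "ideal_convergent I x l \<longleftrightarrow> (\<forall>\<epsilon>>0. {n. \<bar>x n - l\<bar> \<ge> \<epsilon>} \<in> I)"

definition IQN_convergent ::
    "nat set set \<Rightarrow> 'a set \<Rightarrow> (nat \<Rightarrow> 'a \<Rightarrow> real) \<Rightarrow> ('a \<Rightarrow> real) \<Rightarrow> bool" where
  "IQN_convergent I X f g \<longleftrightarrow>
     (\<exists>\<epsilon> :: nat \<Rightarrow> real.
        (\<forall>n. \<epsilon> n > 0) \<and> ideal_convergent I \<epsilon> 0 \<and>
        (\<forall>x\<in>X. {n. \<bar>f n x - g x\<bar> \<ge> \<epsilon> n} \<in> I))"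

definition pointwise_null_seq :: "'a topology \<Rightarrow> (nat \<Rightarrow> 'a \<Rightarrow> real) \<Rightarrow> bool" where
  "pointwise_null_seq X f \<longleftrightarrow>
     (\<forall>n. continuous_map X euclideanreal (f n)) \<and>
     (\<forall>x\<in>topspace X. (\<lambda>n. f n x) \<longlonglongrightarrow> 0)"

definition IQN_space :: "nat set set \<Rightarrow> 'a topology \<Rightarrow> bool" where
  "IQN_space I X \<longleftrightarrow>
     (\<forall>f. pointwise_null_seq X f \<longrightarrow> IQN_convergent I (topspace X) f (\<lambda>_. 0))"

(* enumerate B is the increasing enumeration of the infinite set B. *)
definition IwQN_space :: "nat set set \<Rightarrow> 'a topology \<Rightarrow> bool" where
  "IwQN_space I X \<longleftrightarrow>
     (\<forall>f. pointwise_null_seq X f \<longrightarrow>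
        (\<exists>B :: nat set. infinite B \<and>
           IQN_convergent I (topspace X) (\<lambda>n. f (enumerate B n)) (\<lambda>_. 0)))"

(* As in Engelking, separation is part of (perfect) normality; normal_space alone does not
   include it.  The minima below are not affected: the Kolmogorov quotient of a
   perfectly normal space without separation axioms is Hausdorff and perfectly normal, is not
   larger, and has the same continuous real functions. *)
definition perfectly_normal_space :: "'a topology \<Rightarrow> bool" where
  "perfectly_normal_space X \<longleftrightarrow>
     Hausdorff_space X \<and> normal_space X \<and> (\<forall>C. closedin X C \<longrightarrow> gdelta_in X C)"

section \<open>Cardinal invariants\<close>

(* The least cardinality of a member of F.  Cardinals are taken on the type 'a set so that
   there is room for a default value when F is empty: this default is strictly larger than
   the cardinality of every set of type 'a set (min_card_empty), the analogue of
   min {} = infinity.  Hence an upper bound on min_card F by the cardinality of a set of type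
   'a set entails that F is non-empty. *)
definition min_card :: "'a set set \<Rightarrow> 'a set rel" where
  "min_card F =
     (if F = {} then |UNIV :: 'a set set|
      else SOME r. (\<exists>A\<in>F. r =o |A| ) \<and> (\<forall>A\<in>F. r \<le>o |A| ))"

lemma min_card_empty: "|A| <o min_card ({} :: 'a set set)" for A :: "'a set"
proof -
  have "|A| \<le>o |UNIV :: 'a set|" by (rule card_of_mono1) simp
  also have "|UNIV :: 'a set| <o |Pow (UNIV :: 'a set)|" by (rule card_of_Pow)
  finally show ?thesis by (simp add: min_card_def)
qed

lemma min_card_nonempty:
  fixes F :: "'a set set"
  assumes "F \<noteq> {}"
  shows "(\<exists>A\<in>F. min_card F =o |A| ) \<and> (\<forall>A\<in>F. min_card F \<le>o |A| )"
proof -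
  have "\<exists>r\<in>card_of ` F. \<forall>r'\<in>card_of ` F. r \<le>o r'"
    using assms by (intro exists_minim_Card_order) (simp_all add: card_of_Card_order)
  then obtain A where A: "A \<in> F" "\<forall>B\<in>F. |A| \<le>o |B|" by auto
  define r where "r = |(\<lambda>x. {x}) ` A|"
  have r: "r =o |A|"
    unfolding r_def by (intro ordIso_symmetric[OF card_of_ordIsoI[OF inj_on_imp_bij_betw]]) (simp add: inj_on_def)
  have "\<forall>B\<in>F. r \<le>o |B|"
    using A(2) by (intro ballI ordIso_ordLeq_trans[OF r]) (rule bspec)
  with r A(1) have "(\<exists>A\<in>F. r =o |A| ) \<and> (\<forall>A\<in>F. r \<le>o |A| )" by (intro conjI bexI)
  then have "\<exists>r :: 'a set rel. (\<exists>A\<in>F. r =o |A| ) \<and> (\<forall>A\<in>F. r \<le>o |A| )" by (rule exI)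
  from someI_ex[OF this] assms show ?thesis by (simp add: min_card_def)
qed

(* In the next two definitions the type 'a serves as the universe from which the points of the
   spaces are taken.  A topology on 'a has an arbitrary set topspace X of type 'a set as its
   underlying set. *)
definition non_IQN :: "'a itself \<Rightarrow> nat set set \<Rightarrow> 'a set rel" where
  "non_IQN _ I =
     min_card {topspace X | X :: 'a topology. perfectly_normal_space X \<and> \<not> IQN_space I X}"

definition non_IwQN :: "'a itself \<Rightarrow> nat set set \<Rightarrow> 'a set rel" where
  "non_IwQN _ I =
     min_card {topspace X | X :: 'a topology. perfectly_normal_space X \<and> \<not> IwQN_space I X}"

(* The partition is indexed by the integers n \<ge> -1; other values of B are irrelevant. *)
definition kappa_family :: "nat set set \<Rightarrow> (nat \<Rightarrow> nat set) set \<Rightarrow> bool" where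
  "kappa_family I \<A> \<longleftrightarrow>
     (\<forall>A\<in>\<A>. \<forall>n. finite (A n)) \<and>
     (\<forall>B :: int \<Rightarrow> nat set.
        let U = (\<Union>n::nat. B (int n)) in
        disjoint_family_on B {-1..} \<and> (\<Union>n\<in>{-1..}. B n) = UNIV \<and> infinite U \<and>
        (\<forall>n::nat. enumerate U -` B (int n) \<in> I) \<longrightarrow>
        (\<exists>A\<in>\<A>. enumerate U -` (\<Union>n::nat. A n \<inter> B (int n)) \<notin> I))"

definition kappa :: "nat set set \<Rightarrow> (nat \<Rightarrow> nat set) set rel" where
  "kappa I = min_card {\<A>. kappa_family I \<A>}"

definition le_star :: "(nat \<Rightarrow> nat) \<Rightarrow> (nat \<Rightarrow> nat) \<Rightarrow> bool" where
  "le_star f g \<longleftrightarrow> (\<forall>\<^sub>F n in sequentially. f n \<le> g n)"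

definition bounding_number :: "(nat \<Rightarrow> nat) set rel" where
  "bounding_number = min_card {F. \<not> (\<exists>g. \<forall>f\<in>F. le_star f g)}"

definition dominating_number :: "(nat \<Rightarrow> nat) set rel" where
  "dominating_number = min_card {D. \<forall>f. \<exists>g\<in>D. le_star f g}"

end

(* A pointwise null sequence on fewer than b points has moduli of convergence with a common
   eventual bound, so it converges quasi-normally.  A null sequence (f_k) also assigns to each
   point x the finite sets {k. |f_k(x)| >= 1/(n+1)}, and a control sequence corresponds to the
   partition of the index set according to its size; conversely every kappa-family, viewed as a
   discrete space, carries the null sequence f_k(A) = max {1/(n+1). k in A_n}.  This identifies
   kappa with the minimal size of a non-IwQN-space.  The bound by d takes the initial segments
   below the members of a dominating family.  If the ideal is Katetov-below an F-sigma ideal,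
   written as an increasing union of closed sets K_n, compactness yields finite subsets of the
   tails of the partition with no superset in K_n, and an unbounded family of monotone functions
   catches infinitely many of them. *)
theory Submission
  imports Defs
begin

section \<open>Least cardinalities and the default value for an empty family\<close>

section \<open>Minimal cardinalities\<close>

lemma min_card_le: "A \<in> F \<Longrightarrow> min_card F \<le>o |A|"
  using min_card_nonempty[of F] by blast

lemma min_card_attained: "F \<noteq> {} \<Longrightarrow> \<exists>A\<in>F. min_card F =o |A|"
  using min_card_nonempty[of F] by blast

text \<open>The second hypothesis covers the empty family, for which \<open>min_card\<close> takes
  its default value.\<close>

lemma le_min_card:
  fixes F :: "'a set set"
  assumes "\<And>A. A \<in> F \<Longrightarrow> r \<le>o |A|" and "r \<le>o |UNIV :: 'a set set|"
  shows "r \<le>o min_card F"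
proof (cases "F = {}")
  case True
  with assms(2) show ?thesis by (simp add: min_card_def)
next
  case False
  then obtain A where "A \<in> F" "min_card F =o |A|"
    using min_card_attained by blast
  with assms(1) show ?thesis
    using ordLeq_ordIso_trans ordIso_symmetric by blast
qed

lemma min_card_le_UNIV:
  fixes F :: "'a set set"
  assumes "F \<noteq> {}"
  shows "min_card F \<le>o |UNIV :: 'a set|"
proof -
  obtain A where "A \<in> F" using assms by blast
  with min_card_le have "min_card F \<le>o |A|" by blast
  also have "|A| \<le>o |UNIV :: 'a set|" by (rule card_of_mono1) simp
  finally show ?thesis .
qed

lemma min_card_antimono:
  fixes F G :: "'a set set"
  assumes "F \<subseteq> G"
  shows "min_card G \<le>o min_card F"
proof (cases "G = {}")
  case True
  with assms have "F = G" by blast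
  with True show ?thesis by (simp add: min_card_def card_of_refl ordIso_imp_ordLeq)
next
  case False
  have "min_card G \<le>o |UNIV :: 'a set|"
    by (rule min_card_le_UNIV[OF False])
  also have "|UNIV :: 'a set| \<le>o |UNIV :: 'a set set|"
    using card_of_Pow[of "UNIV :: 'a set"] by (simp add: ordLess_imp_ordLeq)
  finally show ?thesis
    using assms by (intro le_min_card) (auto intro: min_card_le)
qed

text \<open>A sequence of sets is coded by its graph, which pairing of naturals turns into a single
  set of naturals.\<close>

lemma card_of_UNIV_seq_sets: "|UNIV :: (nat \<Rightarrow> nat set) set| \<le>o |UNIV :: nat set set|"
proof (rule card_of_ordLeqI)
  show "inj (\<lambda>A :: nat \<Rightarrow> nat set. prod_encode ` Sigma UNIV A)"
    by (rule injI) (force simp: inj_image_eq_iff[OF inj_prod_encode] fun_eq_iff Sigma_def)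
qed auto

lemma card_of_UNIV_nat_fun: "|UNIV :: (nat \<Rightarrow> nat) set| \<le>o |UNIV :: nat set set|"
proof -
  have "|UNIV :: (nat \<Rightarrow> nat) set| \<le>o |UNIV :: (nat \<Rightarrow> nat set) set|"
    by (rule card_of_ordLeqI[of "\<lambda>f n. {f n}"]) (auto simp: inj_def fun_eq_iff)
  then show ?thesis
    using card_of_UNIV_seq_sets by (rule ordLeq_transitive)
qed

section \<open>Ideals\<close>

lemma
  assumes "ideal_on M I"
  shows ideal_finite: "A \<subseteq> M \<Longrightarrow> finite A \<Longrightarrow> A \<in> I"
    and ideal_subset: "A \<in> I \<Longrightarrow> B \<subseteq> A \<Longrightarrow> B \<in> I"
    and ideal_Un: "A \<in> I \<Longrightarrow> B \<in> I \<Longrightarrow> A \<union> B \<in> I"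
  using assms unfolding ideal_on_def by blast+

lemma ideal_not_top:
  assumes "ideal_on M I"
  shows "M \<notin> I"
proof
  assume "M \<in> I"
  then have "Pow M \<subseteq> I" using ideal_subset[OF assms] by blast
  with assms show False unfolding ideal_on_def by blast
qed

lemma ideal_finite_UN:
  assumes "ideal_on M I" "finite K" "\<And>k. k \<in> K \<Longrightarrow> A k \<in> I"
  shows "(\<Union>k\<in>K. A k) \<in> I"
  using assms(2,3)
proof (induction K rule: finite_induct)
  case empty
  then show ?case using ideal_finite[OF assms(1)] by simp
next
  case (insert x K)
  then show ?case using ideal_Un[OF assms(1)] by simp
qed

section \<open>Quasi-normal convergence and the lower bound by b\<close>

section \<open>The bounding number and IQN-spaces\<close>

lemma bounding_number_le: "\<not> (\<exists>g. \<forall>f\<in>F. le_star f g) \<Longrightarrow> bounding_number \<le>o |F|"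
  unfolding bounding_number_def by (rule min_card_le) simp

lemma unbounded_UNIV: "\<not> (\<exists>g. \<forall>f\<in>UNIV. le_star f g)"
proof
  assume "\<exists>g. \<forall>f\<in>UNIV. le_star f g"
  then obtain g where g: "\<And>f. le_star f g" by auto
  have "\<forall>\<^sub>F n in sequentially. Suc (g n) \<le> g n"
    using g[of "\<lambda>n. Suc (g n)"] by (simp add: le_star_def)
  then show False by simp
qed

text \<open>Guarantees that \<open>bounding_number\<close> is attained by an actual unbounded family
  and is not the default of \<open>min_card\<close>.\<close>

lemma unbounded_nonempty: "{F. \<not> (\<exists>g. \<forall>f\<in>F. le_star f g)} \<noteq> {}"
  using unbounded_UNIV by blast

lemma dominating_nonempty: "{D. \<forall>f. \<exists>g\<in>D. le_star f g} \<noteq> {}"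
proof -
  have "UNIV \<in> {D. \<forall>f. \<exists>g\<in>D. le_star f g}" by (auto simp: le_star_def intro: eventuallyI)
  then show ?thesis by blast
qed

text \<open>The common bound tells how small a control sequence may be at index n: accuracy 1/(k+1)
  is demanded only once n has passed the bound for k. Each point then violates the control sequence
  only finitely often, and finite sets belong to \<open>I\<close>.\<close>

lemma IQN_convergent_of_bounded_moduli:
  assumes I: "ideal_on UNIV I"
    and modulus: "\<And>x k n. x \<in> X \<Longrightarrow> n \<ge> m x k \<Longrightarrow> \<bar>f n x\<bar> < 1 / Suc k"
    and g: "\<And>x. x \<in> X \<Longrightarrow> le_star (m x) g"
  shows "IQN_convergent I X f (\<lambda>_. 0)"
proof -
  \<comment> \<open>Summing the successors gives a strictly increasing function above
    \<open>g\<close>.\<close>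
  define h where "h k = (\<Sum>i\<le>k. Suc (g i))" for k
  have h_ge: "g k \<le> h k" for k
    unfolding h_def using member_le_sum[of k "{..k}" "\<lambda>i. Suc (g i)"] by simp
  have h_Suc: "h k < h (Suc k)" for k
    by (simp add: h_def)
  then have "strict_mono h" by (simp add: strict_mono_Suc_iff)
  \<comment> \<open>The alternative \<open>k = 0\<close> provides a value when n lies below
    \<open>h 0\<close>; the candidates are bounded by n because \<open>h\<close> is strictly
    increasing.\<close>
  define level where "level n = (GREATEST k. k = 0 \<or> h k \<le> n)" for n
  have bound: "k = 0 \<or> h k \<le> n \<Longrightarrow> k \<le> n" for k n
    using strict_mono_imp_increasing[OF \<open>strict_mono h\<close>, of k] by auto
  have level: "level n = 0 \<or> h (level n) \<le> n" for n
    unfolding level_def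
    by (rule GreatestI_nat[where P = "\<lambda>k. k = 0 \<or> h k \<le> n" and k = 0 and b = n])
      (simp, erule bound)
  have level_ge: "k \<le> level n" if "h k \<le> n" for k n
    unfolding level_def
    by (rule Greatest_le_nat[where P = "\<lambda>k. k = 0 \<or> h k \<le> n" and b = n])
      (simp add: that, erule bound)
  define \<epsilon> where "\<epsilon> n = 1 / real (Suc (level n))" for n
  have conv: "ideal_convergent I \<epsilon> 0"
    unfolding ideal_convergent_def
  proof (intro allI impI)
    fix \<delta> :: real assume "\<delta> > 0"
    then obtain k where k: "1 / real (Suc k) < \<delta>"
      using nat_approx_posE by blast
    have "{n. \<bar>\<epsilon> n - 0\<bar> \<ge> \<delta>} \<subseteq> {..<h k}"
    proof
      fix n assume n: "n \<in> {n. \<bar>\<epsilon> n - 0\<bar> \<ge> \<delta>}"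
      show "n \<in> {..<h k}"
      proof (rule ccontr)
        assume "n \<notin> {..<h k}"
        then have "k \<le> level n" by (intro level_ge) simp
        then have "\<epsilon> n \<le> 1 / real (Suc k)" by (simp add: \<epsilon>_def frac_le)
        with n k show False by (simp add: \<epsilon>_def)
      qed
    qed
    then have "finite {n. \<bar>\<epsilon> n - 0\<bar> \<ge> \<delta>}" by (rule finite_subset) simp
    then show "{n. \<bar>\<epsilon> n - 0\<bar> \<ge> \<delta>} \<in> I" by (rule ideal_finite[OF I subset_UNIV])
  qed
  have small: "{n. \<bar>f n x - 0\<bar> \<ge> \<epsilon> n} \<in> I" if x: "x \<in> X" for x
  proof -
    obtain N where N: "\<And>k. k \<ge> N \<Longrightarrow> m x k \<le> g k"
      using g[OF x] by (auto simp: le_star_def eventually_sequentially)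
    \<comment> \<open>With \<open>Suc N\<close> instead of \<open>N\<close> the level is positive,
      so \<open>h (level n) \<le> n\<close> really holds and the default case of
      \<open>level\<close> is excluded.\<close>
    have "{n. \<bar>f n x - 0\<bar> \<ge> \<epsilon> n} \<subseteq> {..<h (Suc N)}"
    proof
      fix n assume n: "n \<in> {n. \<bar>f n x - 0\<bar> \<ge> \<epsilon> n}"
      show "n \<in> {..<h (Suc N)}"
      proof (rule ccontr)
        assume "n \<notin> {..<h (Suc N)}"
        then have "Suc N \<le> level n" by (intro level_ge) simp
        then have "h (level n) \<le> n" "m x (level n) \<le> g (level n)"
          using level[of n] by (auto intro: N)
        then have "m x (level n) \<le> n" using h_ge[of "level n"] by linarith
        from modulus[OF x this] n show False by (simp add: \<epsilon>_def)
      qed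
    qed
    then have "finite {n. \<bar>f n x - 0\<bar> \<ge> \<epsilon> n}" by (rule finite_subset) simp
    then show ?thesis by (rule ideal_finite[OF I subset_UNIV])
  qed
  have "\<forall>n. \<epsilon> n > 0" by (simp add: \<epsilon>_def)
  with conv small show ?thesis
    unfolding IQN_convergent_def by (intro exI[of _ \<epsilon>] conjI ballI)
qed

text \<open>The moduli of convergence of a sequence that fails to converge quasi-normally form an
  unbounded family indexed by the points.\<close>

lemma bounding_number_le_non_IQN_space:
  assumes I: "ideal_on UNIV I" and "\<not> IQN_space I X"
  shows "bounding_number \<le>o |topspace X|"
proof -
  obtain f where f: "pointwise_null_seq X f" "\<not> IQN_convergent I (topspace X) f (\<lambda>_. 0)"
    using assms(2) unfolding IQN_space_def by blast
  have "\<forall>x k. \<exists>m. x \<in> topspace X \<longrightarrow> (\<forall>n\<ge>m. \<bar>f n x\<bar> < 1 / Suc k)"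
  proof (intro allI)
    fix x k
    show "\<exists>m. x \<in> topspace X \<longrightarrow> (\<forall>n\<ge>m. \<bar>f n x\<bar> < 1 / Suc k)"
    proof (cases "x \<in> topspace X")
      case True
      with f(1) have "(\<lambda>n. f n x) \<longlonglongrightarrow> 0" by (simp add: pointwise_null_seq_def)
      then have "\<exists>m. \<forall>n\<ge>m. norm (f n x - 0) < 1 / Suc k"
        by (rule LIMSEQ_D) simp
      then show ?thesis by simp
    qed simp
  qed
  then obtain m where m: "\<And>x k n. x \<in> topspace X \<Longrightarrow> n \<ge> m x k \<Longrightarrow> \<bar>f n x\<bar> < 1 / Suc k"
    by metis
  have "bounding_number \<le>o |m ` topspace X|"
  proof (rule bounding_number_le, rule notI)
    assume "\<exists>g. \<forall>h\<in>m ` topspace X. le_star h g"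
    then obtain g where "\<And>x. x \<in> topspace X \<Longrightarrow> le_star (m x) g" by blast
    with m have "IQN_convergent I (topspace X) f (\<lambda>_. 0)"
      by (rule IQN_convergent_of_bounded_moduli[OF I])
    with f(2) show False by contradiction
  qed
  also have "|m ` topspace X| \<le>o |topspace X|" by (rule card_of_image)
  finally show ?thesis .
qed

lemma bounding_number_le_non_IQN:
  assumes "|UNIV :: nat set set| \<le>o |UNIV :: 'a set|" and I: "ideal_on UNIV I"
  shows "bounding_number \<le>o non_IQN TYPE('a) I"
  unfolding non_IQN_def
proof (rule le_min_card)
  \<comment> \<open>This chain handles the default value, which \<open>non_IQN\<close> would take if
    no space on \<open>'a\<close> failed to be an IQN-space.\<close>
  have "bounding_number \<le>o |UNIV :: (nat \<Rightarrow> nat) set|"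
    unfolding bounding_number_def by (rule min_card_le_UNIV[OF unbounded_nonempty])
  also note card_of_UNIV_nat_fun
  also note assms(1)
  also have "|UNIV :: 'a set| \<le>o |UNIV :: 'a set set|"
    using card_of_Pow[of "UNIV :: 'a set"] by (simp add: ordLess_imp_ordLeq)
  finally show "bounding_number \<le>o |UNIV :: 'a set set|" .
qed (use bounding_number_le_non_IQN_space[OF I] in blast)

lemma IQN_imp_IwQN_space:
  assumes "IQN_space I X"
  shows "IwQN_space I X"
proof -
  have enum: "enumerate (UNIV :: nat set) n = n" for n
  proof (induction n)
    case 0
    show ?case by (simp add: enumerate_0)
  next
    case (Suc n)
    have "(LEAST s. n < s) = Suc n" by (rule Least_equality) auto
    with Suc show ?case by (simp add: enumerate_Suc'' del: enumerate_Suc)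
  qed
  show ?thesis
    unfolding IwQN_space_def
  proof (intro allI impI exI conjI)
    fix f assume "pointwise_null_seq X f"
    with assms show "IQN_convergent I (topspace X) (\<lambda>n. f (enumerate UNIV n)) (\<lambda>_. 0)"
      unfolding IQN_space_def enum by simp
  qed (rule infinite_UNIV_nat)
qed

lemma non_IQN_le_non_IwQN: "non_IQN TYPE('a) I \<le>o non_IwQN TYPE('a) I"
  unfolding non_IQN_def non_IwQN_def
  by (rule min_card_antimono) (use IQN_imp_IwQN_space in blast)

section \<open>Partitions as control sequences: kappa is at most the size of a
  non-IwQN-space\<close>

section \<open>Kappa and IwQN-spaces\<close>

text \<open>Replaces the partition indexed by integers with a disjoint sequence of union
  \<open>U\<close>; the piece at -1 is forgotten.\<close>

lemma kappa_familyI: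
  assumes "\<And>A n. A \<in> \<A> \<Longrightarrow> finite (A n)"
    and "\<And>U P. infinite U \<Longrightarrow> U = (\<Union>n::nat. P n) \<Longrightarrow> disjoint_family P \<Longrightarrow>
      (\<And>n. enumerate U -` P n \<in> I) \<Longrightarrow> \<exists>A\<in>\<A>. enumerate U -` (\<Union>n. A n \<inter> P n) \<notin> I"
  shows "kappa_family I \<A>"
  unfolding kappa_family_def Let_def
proof (intro conjI allI impI ballI)
  fix B :: "int \<Rightarrow> nat set"
  let ?U = "\<Union>n::nat. B (int n)"
  assume B: "disjoint_family_on B {-1..} \<and> (\<Union>n\<in>{-1..}. B n) = UNIV \<and> infinite ?U \<and>
    (\<forall>n::nat. enumerate ?U -` B (int n) \<in> I)"
  have "disjoint_family (\<lambda>n::nat. B (int n))"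
    using B unfolding disjoint_family_on_def by simp
  with B assms(2)[of ?U "\<lambda>n. B (int n)"]
  show "\<exists>A\<in>\<A>. enumerate ?U -` (\<Union>n::nat. A n \<inter> B (int n)) \<notin> I" by simp
qed (use assms(1) in blast)

text \<open>Converse repackaging: the piece at -1 is recovered as the complement of
  \<open>U\<close>.\<close>

lemma kappa_familyD:
  assumes "kappa_family I \<A>" "infinite U" and U: "U = (\<Union>n::nat. P n)"
    and "disjoint_family P" "\<And>n. enumerate U -` P n \<in> I"
  obtains A where "A \<in> \<A>" "enumerate U -` (\<Union>n. A n \<inter> P n) \<notin> I"
proof -
  define B :: "int \<Rightarrow> nat set" where "B k = (if k < 0 then - U else P (nat k))" for k
  have B: "B (int n) = P n" "B (-1) = - U" for n by (simp_all add: B_def)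
  have index: "k = -1 \<or> (\<exists>n. k = int n)" if "k \<in> {-1..}" for k
    using that by (cases k) auto
  have P_U: "P n \<subseteq> U" for n unfolding U by blast
  have "disjoint_family_on B {-1..}"
    unfolding disjoint_family_on_def
  proof (intro ballI impI)
    fix i j :: int assume ij: "i \<in> {-1..}" "j \<in> {-1..}" "i \<noteq> j"
    have disj: "P a \<inter> P b = {}" if "a \<noteq> b" for a b
      using assms(4) that unfolding disjoint_family_on_def by simp
    from index[OF ij(1)] index[OF ij(2)] show "B i \<inter> B j = {}"
    proof (elim disjE exE)
      fix a b assume "i = int a" "j = int b"
      with ij(3) show ?thesis by (simp add: B disj)
    next
      fix a assume "i = int a" "j = -1"
      with P_U[of a] show ?thesis by (auto simp: B)
    next
      fix b assume "i = -1" "j = int b"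
      with P_U[of b] show ?thesis by (auto simp: B)
    qed (use ij(3) in simp)
  qed
  moreover have "(\<Union>n\<in>{-1..}. B n) = UNIV"
  proof -
    have "B (-1) \<union> (\<Union>n. B (int n)) \<subseteq> (\<Union>n\<in>{-1..}. B n)"
      by (intro Un_least UN_least UN_upper) auto
    moreover have "B (-1) \<union> (\<Union>n. B (int n)) = UNIV"
      unfolding B U[symmetric] by (rule Compl_partition2)
    ultimately show ?thesis by (simp only: top.extremum_unique)
  qed
  ultimately have "\<exists>A\<in>\<A>. enumerate U -` (\<Union>n. A n \<inter> P n) \<notin> I"
    by (intro assms(1)[unfolded kappa_family_def Let_def, THEN conjunct2, THEN spec[of _ B],
        unfolded B, folded U, THEN mp] conjI allI assms(2,5))
  then show ?thesis using that by blast
qed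

text \<open>A bad sequence yields the finite sets on which it is at least 1/(n+1) at a given point.
  A partition defeating all of these would supply a control sequence along \<open>U\<close>,
  contrary to the choice of the sequence.\<close>

lemma kappa_le_non_IwQN_space:
  assumes I: "ideal_on UNIV I" and "\<not> IwQN_space I X"
  shows "kappa I \<le>o |topspace X|"
proof -
  obtain f where f: "pointwise_null_seq X f"
    and notconv: "\<And>B. infinite B \<Longrightarrow>
      \<not> IQN_convergent I (topspace X) (\<lambda>n. f (enumerate B n)) (\<lambda>_. 0)"
    using assms(2) unfolding IwQN_space_def by blast
  define A where "A x n = {k. 1 / Suc n \<le> \<bar>f k x\<bar>}" for x n
  have "kappa_family I (A ` topspace X)"
  proof (rule kappa_familyI)
    fix A' n assume "A' \<in> A ` topspace X"
    then obtain x where x: "x \<in> topspace X" "A' = A x" by blast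
    with f have "(\<lambda>n. f n x) \<longlonglongrightarrow> 0" by (simp add: pointwise_null_seq_def)
    then have "\<exists>m. \<forall>k\<ge>m. norm (f k x - 0) < 1 / Suc n"
      by (rule LIMSEQ_D) simp
    then obtain m where m: "\<And>k. k \<ge> m \<Longrightarrow> \<bar>f k x\<bar> < 1 / Suc n" by auto
    have "A x n \<subseteq> {..<m}"
      unfolding A_def using m by (force simp: not_less[symmetric])
    then show "finite (A' n)" using x(2) finite_subset by blast
  next
    fix U :: "nat set" and P
    assume U: "infinite U" "U = (\<Union>n::nat. P n)" and P: "disjoint_family P"
      and PI: "\<And>n. enumerate U -` P n \<in> I"
    have "\<exists>n. enumerate U k \<in> P n" for k
      using enumerate_in_set[OF U(1), of k] U(2) by blast
    then obtain p where p: "\<And>k. enumerate U k \<in> P (p k)" by metis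
    have p_unique: "n = p k" if "enumerate U k \<in> P n" for n k
      using P p[of k] that unfolding disjoint_family_on_def by blast
    \<comment> \<open>The control sequence is 1/(n+1) on the n-th piece, so values above any
      positive bound occupy finitely many pieces, each with preimage in \<open>I\<close>.\<close>
    define \<epsilon> where "\<epsilon> k = 1 / real (Suc (p k))" for k
    have conv: "ideal_convergent I \<epsilon> 0"
      unfolding ideal_convergent_def
    proof (intro allI impI)
      fix \<delta> :: real assume "\<delta> > 0"
      then obtain m where m: "1 / real (Suc m) < \<delta>"
        using nat_approx_posE by blast
      have "{n. \<bar>\<epsilon> n - 0\<bar> \<ge> \<delta>} \<subseteq> (\<Union>n<m. enumerate U -` P n)"
      proof
        fix n assume n: "n \<in> {n. \<bar>\<epsilon> n - 0\<bar> \<ge> \<delta>}"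
        have "p n < m"
        proof (rule ccontr)
          assume "\<not> p n < m"
          then have "\<epsilon> n \<le> 1 / real (Suc m)" by (simp add: \<epsilon>_def frac_le)
          with n m show False by (simp add: \<epsilon>_def)
        qed
        with p[of n] show "n \<in> (\<Union>n<m. enumerate U -` P n)" by blast
      qed
      moreover have "(\<Union>n<m. enumerate U -` P n) \<in> I"
        using PI by (intro ideal_finite_UN[OF I]) auto
      ultimately show "{n. \<bar>\<epsilon> n - 0\<bar> \<ge> \<delta>} \<in> I" using ideal_subset[OF I] by blast
    qed
    have "\<forall>n. \<epsilon> n > 0" by (simp add: \<epsilon>_def)
    with conv have "IQN_convergent I (topspace X) (\<lambda>n. f (enumerate U n)) (\<lambda>_. 0)"
      if "\<forall>x\<in>topspace X. {n. \<bar>f (enumerate U n) x - 0\<bar> \<ge> \<epsilon> n} \<in> I"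
      unfolding IQN_convergent_def using that by (intro exI[of _ \<epsilon>] conjI)
    with notconv[OF U(1)] obtain x where x: "x \<in> topspace X"
        and "{n. \<bar>f (enumerate U n) x - 0\<bar> \<ge> \<epsilon> n} \<notin> I"
      by blast
    \<comment> \<open>Since \<open>enumerate U k\<close> lies in the piece \<open>p k\<close> only,
      the threshold in the set on the right is exactly \<open>\<epsilon> k\<close>.\<close>
    moreover have "{n. \<bar>f (enumerate U n) x - 0\<bar> \<ge> \<epsilon> n} = enumerate U -` (\<Union>n. A x n \<inter> P n)"
      using p by (auto simp: A_def \<epsilon>_def dest!: p_unique)
    ultimately show "\<exists>A\<in>A ` topspace X. enumerate U -` (\<Union>n. A n \<inter> P n) \<notin> I" by auto
  qed
  then have "kappa I \<le>o |A ` topspace X|"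
    unfolding kappa_def by (intro min_card_le) simp
  also have "|A ` topspace X| \<le>o |topspace X|" by (rule card_of_image)
  finally show ?thesis .
qed

section \<open>Discrete spaces carrying kappa-families\<close>

lemma perfectly_normal_discrete: "perfectly_normal_space (discrete_topology S)"
  unfolding perfectly_normal_space_def
  by (auto simp: Hausdorff_space_discrete_topology normal_space_discrete_topology
      intro!: open_imp_gdelta_in)

text \<open>On a discrete space continuity is automatic, so a kappa-family may be read as a null
  sequence. A control sequence along \<open>U\<close> would sort \<open>U\<close> into pieces by
  size, and the family catches this partition at some point. The labelling \<open>A\<close> lets the
  points come from any type.\<close>

lemma not_IwQN_space_discrete:
  assumes I: "ideal_on UNIV I" and kf: "kappa_family I (A ` S)"
  shows "\<not> IwQN_space I (discrete_topology S)"
proof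
  assume IwQN: "IwQN_space I (discrete_topology S)"
  \<comment> \<open>The least index n with k in \<open>A x n\<close> gives the largest value
    1/(n+1).\<close>
  define f :: "nat \<Rightarrow> 'a \<Rightarrow> real" where
    "f k x = (if \<exists>n. k \<in> A x n then 1 / Suc (LEAST n. k \<in> A x n) else 0)" for k x
  have f_ge: "1 / Suc n \<le> f k x" if "k \<in> A x n" for k x n
    using that Least_le[of "\<lambda>n. k \<in> A x n" n] by (auto simp: f_def intro!: frac_le)
  have f_less: "f k x < 1 / Suc n" if "k \<notin> (\<Union>i\<le>n. A x i)" for k x n
  proof (cases "\<exists>i. k \<in> A x i")
    case True
    then have "k \<in> A x (LEAST i. k \<in> A x i)" by (rule LeastI_ex)
    with that have "n < (LEAST i. k \<in> A x i)" by (meson UN_I atMost_iff not_less)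
    with True show ?thesis by (simp add: f_def frac_less2)
  qed (simp add: f_def)
  have f_nonneg: "0 \<le> f k x" for k x by (simp add: f_def)
  have "pointwise_null_seq (discrete_topology S) f"
    unfolding pointwise_null_seq_def
  proof (intro conjI allI ballI)
    fix x assume "x \<in> topspace (discrete_topology S)"
    then have fin: "finite (A x i)" for i
      using kf unfolding kappa_family_def by auto
    show "(\<lambda>n. f n x) \<longlonglongrightarrow> 0"
    proof (rule LIMSEQ_I)
      fix \<delta> :: real assume "\<delta> > 0"
      then obtain n where n: "1 / real (Suc n) < \<delta>"
        using nat_approx_posE by blast
      have "finite (\<Union>i\<le>n. A x i)" using fin by simp
      then obtain N where "\<forall>k\<in>(\<Union>i\<le>n. A x i). k < N"
        unfolding finite_nat_set_iff_bounded by blast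
      then have "f k x < \<delta>" if "k \<ge> N" for k
        using that f_less[of k x n] n by fastforce
      with f_nonneg show "\<exists>N. \<forall>k\<ge>N. norm (f k x - 0) < \<delta>" by auto
    qed
  qed simp
  with IwQN obtain U where U: "infinite U"
    and "IQN_convergent I (topspace (discrete_topology S)) (\<lambda>n. f (enumerate U n)) (\<lambda>_. 0)"
    unfolding IwQN_space_def by blast
  then obtain \<epsilon> where \<epsilon>_pos: "\<And>n. \<epsilon> n > 0"
    and \<epsilon>_conv: "ideal_convergent I \<epsilon> 0"
    and small: "\<And>x. x \<in> S \<Longrightarrow> {n. \<bar>f (enumerate U n) x - 0\<bar> \<ge> \<epsilon> n} \<in> I"
    unfolding IQN_convergent_def topspace_discrete_topology by blast
  (* Terms of the control sequence above 1 are truncated to 1; this affects only a set in I. *)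
  define p where "p k = nat \<lfloor>1 / min 1 (\<epsilon> k)\<rfloor> - 1" for k
  \<comment> \<open>\<open>p k + 1\<close> is the integer part of the reciprocal. The first bound
    makes \<open>f\<close> large on \<open>A x (p k)\<close>; the second puts the n-th piece inside
    the set where \<open>\<epsilon>\<close> is at least 1/(n+2), which lies in
    \<open>I\<close>.\<close>
  have p: "min 1 (\<epsilon> k) \<le> 1 / Suc (p k)" "1 / Suc (Suc (p k)) < min 1 (\<epsilon> k)" for k
  proof -
    let ?r = "1 / min 1 (\<epsilon> k)"
    have r: "?r \<ge> 1" using \<epsilon>_pos[of k] by (simp add: min_def)
    then have "\<lfloor>?r\<rfloor> \<ge> 1" by linarith
    then have eq: "real (Suc (p k)) = of_int \<lfloor>?r\<rfloor>" unfolding p_def by linarith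
    have "real (Suc (p k)) \<le> ?r" "?r < real (Suc (Suc (p k)))" using eq by linarith+
    moreover have "0 < min 1 (\<epsilon> k)" using \<epsilon>_pos[of k] by simp
    ultimately show "min 1 (\<epsilon> k) \<le> 1 / Suc (p k)" "1 / Suc (Suc (p k)) < min 1 (\<epsilon> k)"
      by (simp_all add: field_simps del: of_nat_Suc min_less_iff_conj)
  qed
  have inj: "inj (enumerate U)" and ran: "range (enumerate U) = U"
    using U by (auto simp: inj_enumerate range_enumerate)
  define P where "P n = enumerate U ` {k. p k = n}" for n
  have PE: "enumerate U k \<in> P n \<longleftrightarrow> p k = n" for k n
    using inj by (auto simp: P_def inj_eq)
  have "(\<Union>n. P n) = range (enumerate U)" unfolding P_def by blast
  with ran have "U = (\<Union>n. P n)" by simp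
  moreover have "disjoint_family P"
    using inj by (auto simp: disjoint_family_on_def P_def inj_eq)
  moreover have "enumerate U -` P n \<in> I" for n
  proof -
    have "{k. \<bar>\<epsilon> k - 0\<bar> \<ge> 1 / Suc (Suc n)} \<in> I"
      using \<epsilon>_conv unfolding ideal_convergent_def by simp
    moreover have "enumerate U -` P n \<subseteq> {k. \<bar>\<epsilon> k - 0\<bar> \<ge> 1 / Suc (Suc n)}"
    proof
      fix k assume "k \<in> enumerate U -` P n"
      then have "p k = n" by (simp add: PE)
      with p(2)[of k] show "k \<in> {k. \<bar>\<epsilon> k - 0\<bar> \<ge> 1 / Suc (Suc n)}" by simp
    qed
    ultimately show ?thesis by (rule ideal_subset[OF I])
  qed
  ultimately obtain x where x: "x \<in> S" "enumerate U -` (\<Union>n. A x n \<inter> P n) \<notin> I"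
    using kappa_familyD[OF kf U] by blast
  have "{k. \<bar>\<epsilon> k - 0\<bar> \<ge> 1} \<in> I"
    using \<epsilon>_conv unfolding ideal_convergent_def by simp
  with small[OF x(1)] have "{n. \<bar>f (enumerate U n) x - 0\<bar> \<ge> \<epsilon> n} \<union> {k. \<bar>\<epsilon> k - 0\<bar> \<ge> 1} \<in> I"
    by (rule ideal_Un[OF I])
  moreover have "enumerate U -` (\<Union>n. A x n \<inter> P n)
      \<subseteq> {n. \<bar>f (enumerate U n) x - 0\<bar> \<ge> \<epsilon> n} \<union> {k. \<bar>\<epsilon> k - 0\<bar> \<ge> 1}"
  proof
    fix k assume "k \<in> enumerate U -` (\<Union>n. A x n \<inter> P n)"
    then have "enumerate U k \<in> A x (p k)" by (auto simp: PE)
    then have "min 1 (\<epsilon> k) \<le> f (enumerate U k) x"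
      using f_ge p(1)[of k] by (meson order_trans)
    then show "k \<in> {n. \<bar>f (enumerate U n) x - 0\<bar> \<ge> \<epsilon> n} \<union> {k. \<bar>\<epsilon> k - 0\<bar> \<ge> 1}"
      by auto
  qed
  ultimately show False using x(2) ideal_subset[OF I] by blast
qed

text \<open>For the upper bound a kappa-family of least size is copied into \<open>'a\<close> and
  made discrete. The assumption \<open>ex\<close> keeps \<open>kappa\<close> away from its default
  value.\<close>

lemma non_IwQN_eq_kappa:
  assumes card: "|UNIV :: nat set set| \<le>o |UNIV :: 'a set|" and I: "ideal_on UNIV I"
    and ex: "\<exists>\<A>. kappa_family I \<A>"
  shows "non_IwQN TYPE('a) I =o kappa I"
proof (rule ordIso_iff_ordLeq[THEN iffD2], rule conjI)
  have ne: "{\<A>. kappa_family I \<A>} \<noteq> {}" using ex by blast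
  have "kappa I \<le>o |UNIV :: (nat \<Rightarrow> nat set) set|"
    unfolding kappa_def by (rule min_card_le_UNIV[OF ne])
  also note card_of_UNIV_seq_sets
  also note card
  also have "|UNIV :: 'a set| \<le>o |UNIV :: 'a set set|"
    using card_of_Pow[of "UNIV :: 'a set"] by (simp add: ordLess_imp_ordLeq)
  finally show "kappa I \<le>o non_IwQN TYPE('a) I"
    unfolding non_IwQN_def
    by (intro le_min_card) (use kappa_le_non_IwQN_space[OF I] in blast)
next
  obtain \<A> where \<A>: "kappa_family I \<A>" "kappa I =o |\<A>|"
    using min_card_attained[of "{\<A>. kappa_family I \<A>}"] ex unfolding kappa_def by blast
  have "|UNIV :: (nat \<Rightarrow> nat set) set| \<le>o |UNIV :: 'a set|"
    using card_of_UNIV_seq_sets card by (rule ordLeq_transitive)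
  then obtain \<phi> :: "(nat \<Rightarrow> nat set) \<Rightarrow> 'a" where \<phi>: "inj \<phi>"
    unfolding card_of_ordLeq[symmetric] by blast
  \<comment> \<open>The inverse of the injection labels each point with the member of the family it
    stands for.\<close>
  have "inv \<phi> ` \<phi> ` \<A> = \<A>" using \<phi> by (simp add: image_image)
  with \<A>(1) have "\<not> IwQN_space I (discrete_topology (\<phi> ` \<A>))"
    by (intro not_IwQN_space_discrete[OF I, of "inv \<phi>"]) simp
  then have "\<phi> ` \<A> \<in> {topspace X | X. perfectly_normal_space X \<and> \<not> IwQN_space I X}"
    by (intro CollectI exI[of _ "discrete_topology (\<phi> ` \<A>)"])
      (simp add: perfectly_normal_discrete)
  then have "non_IwQN TYPE('a) I \<le>o |\<phi> ` \<A>|"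
    unfolding non_IwQN_def by (rule min_card_le)
  also have "|\<phi> ` \<A>| \<le>o |\<A>|" by (rule card_of_image)
  also have "|\<A>| =o kappa I" by (rule ordIso_symmetric[OF \<A>(2)])
  finally show "non_IwQN TYPE('a) I \<le>o kappa I" .
qed

section \<open>Upper bound by d for weak P-ideals\<close>

section \<open>Upper bounds for kappa\<close>

text \<open>The weak P-property gives a set outside \<open>I\<close> meeting each piece finitely. A
  dominating function bounds these finite parts from some piece on, and the earlier pieces together
  lie in \<open>I\<close>.\<close>

lemma kappa_family_of_dominating:
  assumes wP: "weak_P_ideal UNIV I" and D: "\<forall>f. \<exists>g\<in>D. le_star f g"
  shows "kappa_family I ((\<lambda>h n. {..h n}) ` D)"
proof (rule kappa_familyI)
  have I: "ideal_on UNIV I" using wP by (simp add: weak_P_ideal_def)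
  fix U :: "nat set" and P
  assume U: "infinite U" "U = (\<Union>n::nat. P n)" and P: "disjoint_family P"
    and PI: "\<And>n. enumerate U -` P n \<in> I"
  let ?C = "\<lambda>n. enumerate U -` P n"
  have "disjoint_family ?C" using P by (auto simp: disjoint_family_on_def)
  moreover have cover: "(\<Union>n. ?C n) = UNIV" using enumerate_in_set[OF U(1)] U(2) by blast
  ultimately obtain S where S: "S \<notin> I" "\<And>n. finite (?C n \<inter> S)"
    using wP PI unfolding weak_P_ideal_def by blast
  \<comment> \<open>The inserted 0 gives \<open>Max\<close> a value on pieces that miss
    \<open>S\<close>.\<close>
  define g where "g n = Max (insert 0 (enumerate U ` (?C n \<inter> S)))" for n
  have g: "enumerate U k \<le> g n" if "k \<in> ?C n \<inter> S" for k n
    unfolding g_def using that S(2) by (intro Max_ge) auto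
  obtain h where h: "h \<in> D" "le_star g h" using D by blast
  then obtain N where N: "\<And>n. n \<ge> N \<Longrightarrow> g n \<le> h n"
    by (auto simp: le_star_def eventually_sequentially)
  have "enumerate U -` (\<Union>n. {..h n} \<inter> P n) \<notin> I"
  proof
    assume "enumerate U -` (\<Union>n. {..h n} \<inter> P n) \<in> I"
    moreover have "(\<Union>n<N. ?C n) \<in> I" using PI by (intro ideal_finite_UN[OF I]) auto
    ultimately have "enumerate U -` (\<Union>n. {..h n} \<inter> P n) \<union> (\<Union>n<N. ?C n) \<in> I"
      by (rule ideal_Un[OF I])
    moreover have "S \<subseteq> enumerate U -` (\<Union>n. {..h n} \<inter> P n) \<union> (\<Union>n<N. ?C n)"
    proof
      fix k assume k: "k \<in> S"
      obtain n where n: "k \<in> ?C n" using cover by blast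
      show "k \<in> enumerate U -` (\<Union>n. {..h n} \<inter> P n) \<union> (\<Union>n<N. ?C n)"
      proof (cases "n < N")
        case False
        then have "enumerate U k \<le> h n" using g[of k n] N[of n] n k by force
        with n show ?thesis by blast
      qed (use n in blast)
    qed
    ultimately show False using S(1) ideal_subset[OF I] by blast
  qed
  with h(1) show "\<exists>A\<in>(\<lambda>h n. {..h n}) ` D. enumerate U -` (\<Union>n. A n \<inter> P n) \<notin> I" by auto
qed auto

lemma kappa_le_dominating_number:
  assumes "weak_P_ideal UNIV I"
  shows "kappa I \<le>o dominating_number"
proof -
  obtain D where D: "\<forall>f. \<exists>g\<in>D. le_star f g" "dominating_number =o |D|"
    using min_card_attained[OF dominating_nonempty] unfolding dominating_number_def by blast
  have "kappa I \<le>o |(\<lambda>h n. {..h n}) ` D|"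
    unfolding kappa_def using kappa_family_of_dominating[OF assms D(1)]
    by (intro min_card_le) simp
  also have "|(\<lambda>h n. {..h n}) ` D| \<le>o |D|" by (rule card_of_image)
  also have "|D| =o dominating_number" by (rule ordIso_symmetric[OF D(2)])
  finally show ?thesis .
qed

section \<open>Compactness of the Cantor space and F-sigma ideals\<close>

lemma closedin_cantor_superset: "closedin cantor_topology {x. \<forall>n\<in>s. x n}"
proof -
  have closed: "closedin cantor_topology {x. x n}" for n
  proof -
    have "continuous_map cantor_topology (discrete_topology UNIV) (\<lambda>x. x n)"
      unfolding cantor_topology_def by (rule continuous_map_product_projection) simp
    then have "closedin cantor_topology {x \<in> topspace cantor_topology. x n \<in> {True}}"
      by (rule closedin_continuous_map_preimage) simp
    then show ?thesis by (simp add: cantor_topology_def)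
  qed
  show ?thesis
  proof (cases "s = {}")
    case True
    then have "{x. \<forall>n\<in>s. x n} = topspace cantor_topology"
      by (simp add: cantor_topology_def)
    then show ?thesis by (simp only: closedin_topspace)
  next
    case False
    then have "closedin cantor_topology (\<Inter>n\<in>s. {x. x n})"
      using closed by (intro closedin_Inter) auto
    moreover have "(\<Inter>n\<in>s. {x. x n}) = {x. \<forall>n\<in>s. x n}" by blast
    ultimately show ?thesis by simp
  qed
qed

text \<open>If every finite initial part of \<open>Z\<close> had a superset in \<open>K\<close>, the
  nested nonempty closed sets \<open>C N\<close> would share a point by compactness, and this point
  would be a superset of \<open>Z\<close> in \<open>K\<close>.\<close>

lemma finite_subset_escaping_closed:
  assumes K: "closedin cantor_topology K" and Z: "\<And>Y. Z \<subseteq> Y \<Longrightarrow> (\<lambda>n. n \<in> Y) \<notin> K"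
  obtains s where "finite s" "s \<subseteq> Z" "\<And>Y. s \<subseteq> Y \<Longrightarrow> (\<lambda>n. n \<in> Y) \<notin> K"
proof -
  have compact: "compact_space cantor_topology"
    unfolding cantor_topology_def
    by (simp add: compact_space_product_topology compact_space_discrete_topology)
  define C where "C N = K \<inter> {x. \<forall>n\<in>Z \<inter> {..<N}. x n}" for N
  have "\<exists>N. C N = {}"
  proof (rule ccontr)
    assume "\<nexists>N. C N = {}"
    then have "(\<Inter>N. C N) \<noteq> {}"
      using K by (intro compact_space_imp_nest[OF compact])
        (auto simp: C_def decseq_def intro!: closedin_Int closedin_cantor_superset)
    then obtain x where x: "\<And>N. x \<in> C N" by blast
    have "Z \<subseteq> {n. x n}"
    proof
      fix n assume "n \<in> Z"
      with x[of "Suc n"] show "n \<in> {n. x n}" by (simp add: C_def)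
    qed
    from Z[OF this] x[of 0] show False by (simp add: C_def)
  qed
  then obtain N where N: "C N = {}" by blast
  show ?thesis
  proof (rule that[of "Z \<inter> {..<N}"])
    fix Y assume "Z \<inter> {..<N} \<subseteq> Y"
    with N show "(\<lambda>n. n \<in> Y) \<notin> K" by (fastforce simp: C_def)
  qed auto
qed

text \<open>Each tail of the partition has a finite part with no superset in the n-th closed set. An
  unbounded family has a member exceeding the bounds of these finite parts infinitely often, and
  monotonicity carries this to all later pieces.\<close>

lemma kappa_family_of_unbounded:
  assumes I: "ideal_on UNIV I" and J: "F_sigma_ideal J" and "katetov_le I J"
    and F: "\<not> (\<exists>g. \<forall>f\<in>F. le_star f g)" and mono: "\<And>h. h \<in> F \<Longrightarrow> mono h"
  shows "kappa_family I ((\<lambda>h n. {..h n}) ` F)"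
proof (rule kappa_familyI)
  obtain \<phi> :: "nat \<Rightarrow> nat" where \<phi>: "\<And>A. A \<in> I \<Longrightarrow> \<phi> -` A \<in> J"
    using assms(3) unfolding katetov_le_def by blast
  have J_ideal: "ideal_on UNIV J" using J by (simp add: F_sigma_ideal_def)
  obtain K where K: "\<And>n::nat. closedin cantor_topology (K n)" "\<And>n. K n \<subseteq> K (Suc n)"
    and K_Un: "(\<Union>n. K n) = (\<lambda>A n. n \<in> A) ` J"
    using J unfolding F_sigma_ideal_def fsigma_in_ascending by blast
  have K_le: "K m \<subseteq> K n" if "m \<le> n" for m n
    using that K(2) by (rule lift_Suc_mono_le[rotated])
  have K_J: "Y \<in> J \<longleftrightarrow> (\<exists>n. (\<lambda>i. i \<in> Y) \<in> K n)" for Y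
  proof -
    have "inj (\<lambda>A n. n \<in> (A :: nat set))" by (auto simp: inj_def fun_eq_iff)
    then have "Y \<in> J \<longleftrightarrow> (\<lambda>i. i \<in> Y) \<in> (\<lambda>A n. n \<in> A) ` J"
      by (rule inj_image_mem_iff[symmetric])
    then show ?thesis unfolding K_Un[symmetric] by blast
  qed
  fix U :: "nat set" and P
  assume U: "infinite U" "U = (\<Union>n::nat. P n)" and P: "disjoint_family P"
    and PI: "\<And>n. enumerate U -` P n \<in> I"
  \<comment> \<open>Composing with the Katetov map moves the problem to \<open>J\<close>: preimages
    of the pieces under \<open>g\<close> lie in \<open>J\<close>.\<close>
  define g where "g k = enumerate U (\<phi> k)" for k
  have gP: "g -` P n \<in> J" for n
    using \<phi>[OF PI[of n]] by (simp add: g_def vimage_def)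
  have g_cover: "\<exists>n. g k \<in> P n" for k
    using enumerate_in_set[OF U(1), of "\<phi> k"] U(2) unfolding g_def by blast
  have tail: "\<not> (\<Union>i\<in>{n..}. g -` P i) \<in> J" for n
  proof
    assume "(\<Union>i\<in>{n..}. g -` P i) \<in> J"
    moreover have "(\<Union>i<n. g -` P i) \<in> J"
      using gP by (intro ideal_finite_UN[OF J_ideal]) auto
    ultimately have "(\<Union>i\<in>{n..}. g -` P i) \<union> (\<Union>i<n. g -` P i) \<in> J"
      by (rule ideal_Un[OF J_ideal])
    moreover have "(\<Union>i\<in>{n..}. g -` P i) \<union> (\<Union>i<n. g -` P i) = UNIV"
    proof -
      have "k \<in> (\<Union>i\<in>{n..}. g -` P i) \<union> (\<Union>i<n. g -` P i)" for k
      proof -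
        obtain i where "g k \<in> P i" using g_cover by blast
        then show ?thesis by (cases "n \<le> i") auto
      qed
      then show ?thesis by blast
    qed
    ultimately show False using ideal_not_top[OF J_ideal] by simp
  qed
  \<comment> \<open>No superset of a tail is in \<open>J\<close>, hence none is in
    \<open>K n\<close>, and compactness selects the finite set.\<close>
  have "\<exists>s. finite s \<and> s \<subseteq> (\<Union>i\<in>{n..}. g -` P i) \<and> (\<forall>Y. s \<subseteq> Y \<longrightarrow> (\<lambda>i. i \<in> Y) \<notin> K n)" for n
  proof -
    have "(\<lambda>i. i \<in> Y) \<notin> K n" if "(\<Union>i\<in>{n..}. g -` P i) \<subseteq> Y" for Y
      using tail[of n] ideal_subset[OF J_ideal _ that] K_J by blast
    from finite_subset_escaping_closed[OF K(1) this] show ?thesis by metis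
  qed
  then obtain s where s: "\<And>n. finite (s n)" "\<And>n. s n \<subseteq> (\<Union>i\<in>{n..}. g -` P i)"
    "\<And>n Y. s n \<subseteq> Y \<Longrightarrow> (\<lambda>i. i \<in> Y) \<notin> K n"
    by metis
  define q where "q n = Max (insert 0 (g ` s n))" for n
  have q: "g k \<le> q n" if "k \<in> s n" for k n
    unfolding q_def using that s(1) by (intro Max_ge) auto
  obtain h where h: "h \<in> F" "\<not> le_star h q" using F by blast
  have "enumerate U -` (\<Union>n. {..h n} \<inter> P n) \<notin> I"
  proof
    assume "enumerate U -` (\<Union>n. {..h n} \<inter> P n) \<in> I"
    from \<phi>[OF this] have "g -` (\<Union>n. {..h n} \<inter> P n) \<in> J"
      by (simp add: g_def vimage_def)
    then obtain m where m: "(\<lambda>i. i \<in> g -` (\<Union>n. {..h n} \<inter> P n)) \<in> K m"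
      using K_J by blast
    \<comment> \<open>\<open>h\<close> exceeds \<open>q\<close> arbitrarily late, so n can be taken
      beyond m; then \<open>K m\<close> is contained in \<open>K n\<close>, which the superset of
      \<open>s n\<close> avoids.\<close>
    obtain n where n: "n \<ge> m" "q n < h n"
      using h(2) by (auto simp: le_star_def eventually_sequentially not_le)
    have "s n \<subseteq> g -` (\<Union>n. {..h n} \<inter> P n)"
    proof
      fix k assume k: "k \<in> s n"
      with s(2) obtain i where i: "n \<le> i" "g k \<in> P i" by fastforce
      \<comment> \<open>The element lies in a piece with index \<open>i \<ge> n\<close>, so the
        bound needed is \<open>h i\<close>; it follows from \<open>h n\<close> by
        monotonicity.\<close>
      have "g k \<le> h i"
        using q[OF k] n(2) monoD[OF mono[OF h(1)] i(1)] by linarith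
      with i show "k \<in> g -` (\<Union>n. {..h n} \<inter> P n)" by blast
    qed
    from s(3)[OF this] m K_le[OF n(1)] show False by blast
  qed
  with h(1) show "\<exists>A\<in>(\<lambda>h n. {..h n}) ` F. enumerate U -` (\<Union>n. A n \<inter> P n) \<notin> I" by auto
qed auto

lemma kappa_le_bounding_number:
  assumes "ideal_on UNIV I" "F_sigma_ideal J" "katetov_le I J"
  shows "(\<exists>\<A>. kappa_family I \<A>) \<and> kappa I \<le>o bounding_number"
proof -
  obtain F where F: "\<not> (\<exists>g. \<forall>f\<in>F. le_star f g)" "bounding_number =o |F|"
    using min_card_attained[OF unbounded_nonempty] unfolding bounding_number_def by blast
  \<comment> \<open>Running maxima make the members monotone while keeping the family unbounded and
    no larger.\<close>
  define M :: "(nat \<Rightarrow> nat) \<Rightarrow> nat \<Rightarrow> nat" where "M h n = Max (h ` {..n})" for h n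
  have M_ge: "h n \<le> M h n" for h n unfolding M_def by (intro Max_ge) auto
  have "mono (M h)" for h
    unfolding M_def by (intro monoI Max_mono) auto
  moreover have "\<not> (\<exists>g. \<forall>f\<in>M ` F. le_star f g)"
  proof
    assume "\<exists>g. \<forall>f\<in>M ` F. le_star f g"
    then obtain g where "\<And>f. f \<in> F \<Longrightarrow> le_star (M f) g" by blast
    moreover have "le_star f g" if "le_star (M f) g" for f
      using that unfolding le_star_def by (rule eventually_mono) (rule order_trans[OF M_ge])
    ultimately have "\<forall>f\<in>F. le_star f g" by simp
    with F(1) show False by blast
  qed
  ultimately have kf: "kappa_family I ((\<lambda>h n. {..h n}) ` M ` F)"
    by (intro kappa_family_of_unbounded[OF assms]) auto
  then have "kappa I \<le>o |(\<lambda>h n. {..h n}) ` M ` F|"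
    unfolding kappa_def by (intro min_card_le) simp
  also have "|(\<lambda>h n. {..h n}) ` M ` F| \<le>o |M ` F|" by (rule card_of_image)
  also have "|M ` F| \<le>o |F|" by (rule card_of_image)
  also have "|F| =o bounding_number" by (rule ordIso_symmetric[OF F(2)])
  finally show ?thesis using kf by blast
qed

text \<open>The cardinality assumption provides points in \<open>'a\<close> for the discrete spaces
  and keeps the default values of both \<open>non_IQN\<close> and \<open>non_IwQN\<close> large
  enough for the lower bounds.\<close>

theorem theorem2p7:
  assumes "|UNIV :: nat set set| \<le>o |UNIV :: 'a set|"
  shows
    "(\<forall>I :: nat set set. weak_P_ideal UNIV I \<longrightarrow>
        bounding_number \<le>o non_IQN TYPE('a) I \<and>
        non_IQN TYPE('a) I \<le>o non_IwQN TYPE('a) I \<and>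
        non_IwQN TYPE('a) I =o kappa I \<and>
        kappa I \<le>o dominating_number) \<and>
     (\<forall>I :: nat set set. ideal_on UNIV I \<and> (\<exists>J. F_sigma_ideal J \<and> katetov_le I J) \<longrightarrow>
        non_IQN TYPE('a) I =o non_IwQN TYPE('a) I \<and>
        non_IwQN TYPE('a) I =o kappa I \<and>
        kappa I =o bounding_number)"
proof (intro conjI allI impI; (elim conjE exE)?)
  fix I :: "nat set set" assume wP: "weak_P_ideal UNIV I"
  then have I: "ideal_on UNIV I" by (simp add: weak_P_ideal_def)
  obtain D :: "(nat \<Rightarrow> nat) set" where "\<forall>f. \<exists>g\<in>D. le_star f g"
    using dominating_nonempty by blast
  then have "\<exists>\<A>. kappa_family I \<A>"
    using kappa_family_of_dominating[OF wP] by blast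
  then show "non_IwQN TYPE('a) I =o kappa I"
    by (rule non_IwQN_eq_kappa[OF assms I])
  show "bounding_number \<le>o non_IQN TYPE('a) I"
    by (rule bounding_number_le_non_IQN[OF assms I])
  show "non_IQN TYPE('a) I \<le>o non_IwQN TYPE('a) I"
    by (rule non_IQN_le_non_IwQN)
  show "kappa I \<le>o dominating_number"
    by (rule kappa_le_dominating_number[OF wP])
next
  fix I J :: "nat set set"
  assume I: "ideal_on UNIV I" and J: "F_sigma_ideal J" "katetov_le I J"
  note kappa = kappa_le_bounding_number[OF I J]
  show eq: "non_IwQN TYPE('a) I =o kappa I"
    by (rule non_IwQN_eq_kappa[OF assms I]) (use kappa in blast)
  have b: "bounding_number \<le>o non_IQN TYPE('a) I"
    by (rule bounding_number_le_non_IQN[OF assms I])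
  have le: "non_IQN TYPE('a) I \<le>o non_IwQN TYPE('a) I"
    by (rule non_IQN_le_non_IwQN)
  \<comment> \<open>This closes the cycle from b through \<open>non_IQN\<close>,
    \<open>non_IwQN\<close> and \<open>kappa\<close> back to b, so all four agree.\<close>
  have "non_IwQN TYPE('a) I \<le>o bounding_number"
    using eq kappa ordIso_ordLeq_trans by blast
  from ordLeq_transitive[OF this b] le show "non_IQN TYPE('a) I =o non_IwQN TYPE('a) I"
    by (simp add: ordIso_iff_ordLeq)
  have "bounding_number \<le>o kappa I"
    using ordLeq_transitive[OF b le] eq by (rule ordLeq_ordIso_trans)
  with kappa show "kappa I =o bounding_number"
    by (simp add: ordIso_iff_ordLeq)
qed

end
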